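(* Let $s\in[0,T]$ and $\zeta\in\mathcal P(H)$, and let $\mathcal K\subset\mathcal M_{s,\zeta}$ be a convex subset such that for every $\mu\in\mathcal K$ the following "dense range condition" is satisfied: $$L_0(D(L_0))\ \text{ is dense in }\ L^1([0,T]\times H,\mu).$$ Then $\mathcal K$ contains at most one element.
   Context: Setting. $T>0$ is fixed; $H$ is a separable real Hilbert space with inner product $\langle\cdot,\cdot\rangle$ and norm $|\cdot|$; $\mathcal B(H)$ is its Borel $\sigma$-algebra; $\mathcal P(H)$ is the set of Borel probability measures on $H$; $L(H)$ is the space of bounded linear operators on $H$. $A\colon D(A)\subset H\to H$ is the infinitesimal generator of a $C_0$-semigroup $e^{tA}$, $t\ge0$, on $H$, with adjoint $A^*$. $C\in L(H)$ is symmetric and nonnegative. $D(F)\in\mathcal B([0,T]\times H)$ and $F\colon D(F)\to H$ is measurable; put $|F(t,x)|:=+\infty$ if $(t,x)\notin D(F)$. Kolmogorov operator. $D(L_0):=\mathcal E_A([0,T]\times H)$ is the real linear span of all real parts of functions $u_{\phi,h}(t,x)=\phi(t)e^{i\langle x,h(t)\rangle}$, $(t,x)\in[0,T]\times H$, where $\phi\in C^1([0,T];\mathbb C)$ with $\phi(T)=0$ and $h\in C^1([0,T];D(A^* ))$ ($D(A^* )$ with the graph norm). For $u\in D(L_0)$, $$L_0u(t,x)=D_tu(t,x)+\tfrac12\mathrm{Tr}[CD_x^2u(t,x)]+\langle x,A^*D_xu(t,x)\rangle+\langle F(t,x),D_xu(t,x)\rangle ,$$ where $D_t$ is the time derivative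 and $D_x,D_x^2$ are the first and second Fréchet derivatives in $x$; $L_0u$ is defined on $D(F)$. Solutions of the Fokker–Planck equation. For $s\in[0,T]$ and $\zeta\in\mathcal P(H)$, $\mathcal M_{s,\zeta}$ is the set of all finite nonnegative measures $\mu$ on $[s,T]\times H$ (regarded as measures on $[0,T]\times H$ via extension by zero) such that: (a) $\mu(dt,dx)=\mu_t(dx)\,dt$ with $\mu_t\in\mathcal P(H)$ for all $t\in[s,T]$ and $t\mapsto\mu_t(B)$ measurable on $[s,T]$ for all $B\in\mathcal B(H)$; (b) $\int_{[s,T]\times H}(|\langle y,A^*h(t)\rangle|+|F(t,y)|)\,\mu(dt,dy)<\infty$ for all $h\in C^1([0,T];D(A^* ))$, and $L_0u\in L^1([s,T]\times H,\mu)$ for all $u\in D(L_0)$, so that all integrals in (c) exist; (c) for every $u\in D(L_0)$, $$\int_Hu(t,y)\mu_t(dy)=\int_Hu(s,y)\zeta(dy)+\int_s^t\int_HL_0u(s',y)\,\mu_{s'}(dy)\,ds'\quad\text{for } dt\text{-a.e. }t\in[s,T],$$ where the exceptional $dt$-null set may depend on $u$. *)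

theory Defs
  imports "HOL-Probability.Probability"
begin

section \<open>Semigroups, generators, adjoints and traces on a Hilbert space\<close>

definition C0_semigroup :: "(real \<Rightarrow> 'a::real_normed_vector \<Rightarrow>\<^sub>L 'a) \<Rightarrow> bool" where
  "C0_semigroup S \<longleftrightarrow>
     S 0 = id_blinfun \<and>
     (\<forall>s\<ge>0. \<forall>t\<ge>0. S (s + t) = S s o\<^sub>L S t) \<and>
     (\<forall>x. ((\<lambda>t. blinfun_apply (S t) x) \<longlongrightarrow> x) (at_right 0))"

text \<open>An unbounded operator is a pair of its domain \<open>D\<close> and a total function \<open>A\<close>, of which only
  the values on \<open>D\<close> matter.\<close>

definition is_generator ::
  "(real \<Rightarrow> 'a::real_normed_vector \<Rightarrow>\<^sub>L 'a) \<Rightarrow> 'a set \<Rightarrow> ('a \<Rightarrow> 'a) \<Rightarrow> bool" where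
  "is_generator S D A \<longleftrightarrow>
     D = {x. \<exists>y. ((\<lambda>t. (blinfun_apply (S t) x - x) /\<^sub>R t) \<longlongrightarrow> y) (at_right 0)} \<and>
     (\<forall>x\<in>D. ((\<lambda>t. (blinfun_apply (S t) x - x) /\<^sub>R t) \<longlongrightarrow> A x) (at_right 0))"

definition adj_dom :: "'a::real_inner set \<Rightarrow> ('a \<Rightarrow> 'a) \<Rightarrow> 'a set" where
  "adj_dom D A = {y. \<exists>z. \<forall>x\<in>D. A x \<bullet> y = x \<bullet> z}"

text \<open>The description is unique when \<open>D\<close> is dense, in particular for generators.\<close>

definition adj_op :: "'a::real_inner set \<Rightarrow> ('a \<Rightarrow> 'a) \<Rightarrow> 'a \<Rightarrow> 'a" where
  "adj_op D A y = (THE z. \<forall>x\<in>D. A x \<bullet> y = x \<bullet> z)"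

definition symmetric_nonneg :: "('a::real_inner \<Rightarrow>\<^sub>L 'a) \<Rightarrow> bool" where
  "symmetric_nonneg C \<longleftrightarrow>
     (\<forall>x y. blinfun_apply C x \<bullet> y = x \<bullet> blinfun_apply C y) \<and> (\<forall>x. 0 \<le> blinfun_apply C x \<bullet> x)"

definition orthonormal_basis :: "'a::real_inner set \<Rightarrow> bool" where
  "orthonormal_basis E \<longleftrightarrow>
     (\<forall>e\<in>E. norm e = 1) \<and> pairwise orthogonal E \<and> closure (span E) = UNIV"

text \<open>For trace-class operators the sum does not depend on the basis; below, \<open>op_trace\<close> is only
  applied to operators of finite rank.\<close>

definition op_trace :: "('a::real_inner \<Rightarrow> 'a) \<Rightarrow> real" where
  "op_trace B = (\<Sum>\<^sub>\<infinity>e\<in>(SOME E. orthonormal_basis E). B e \<bullet> e)"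

text \<open>The first Frechet derivative, identified with a vector by the Riesz isomorphism.\<close>

definition grad :: "('a::real_inner \<Rightarrow> real) \<Rightarrow> 'a \<Rightarrow> 'a" where
  "grad f x = (THE g. GDERIV f x :> g)"


section \<open>The Kolmogorov operator\<close>

definition C1_scalar :: "real \<Rightarrow> (real \<Rightarrow> complex) \<Rightarrow> bool" where
  "C1_scalar T \<phi> \<longleftrightarrow>
     (\<exists>\<phi>'. (\<forall>t\<in>{0..T}. (\<phi> has_vector_derivative \<phi>' t) (at t within {0..T})) \<and>
           continuous_on {0..T} \<phi>')"

definition adj_graph_norm :: "'a::real_inner set \<Rightarrow> ('a \<Rightarrow> 'a) \<Rightarrow> 'a \<Rightarrow> real" where
  "adj_graph_norm D A y = norm y + norm (adj_op D A y)"

text \<open>The space $C^1([0,T]; D(A^*))$, with difference quotients and continuity of the derivative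
  taken in the graph norm of $D(A^*)$.\<close>

definition C1_adj_dom :: "real \<Rightarrow> 'a::real_inner set \<Rightarrow> ('a \<Rightarrow> 'a) \<Rightarrow> (real \<Rightarrow> 'a) \<Rightarrow> bool" where
  "C1_adj_dom T D A h \<longleftrightarrow>
     (\<forall>t\<in>{0..T}. h t \<in> adj_dom D A) \<and>
     (\<exists>h'. \<forall>t\<in>{0..T}.
        h' t \<in> adj_dom D A \<and>
        ((\<lambda>r. adj_graph_norm D A ((h r - h t) /\<^sub>R (r - t) - h' t)) \<longlongrightarrow> 0) (at t within {0..T}) \<and>
        ((\<lambda>r. adj_graph_norm D A (h' r - h' t)) \<longlongrightarrow> 0) (at t within {0..T}))"

text \<open>Functions on $[0,T] \times H$ are represented by total functions on
  \<open>real \<times> 'a\<close>; their values at times outside $[0,T]$ are never used.\<close>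

definition exp_fun :: "(real \<Rightarrow> complex) \<Rightarrow> (real \<Rightarrow> 'a::real_inner) \<Rightarrow> real \<times> 'a \<Rightarrow> complex" where
  "exp_fun \<phi> h = (\<lambda>(t, x). \<phi> t * exp (\<i> * complex_of_real (x \<bullet> h t)))"

definition exp_generators :: "real \<Rightarrow> 'a::real_inner set \<Rightarrow> ('a \<Rightarrow> 'a) \<Rightarrow> (real \<times> 'a \<Rightarrow> real) set" where
  "exp_generators T D A =
     {\<lambda>p. Re (exp_fun \<phi> h p) | \<phi> h. C1_scalar T \<phi> \<and> \<phi> T = 0 \<and> C1_adj_dom T D A h}"

definition dom_L0 :: "real \<Rightarrow> 'a::real_inner set \<Rightarrow> ('a \<Rightarrow> 'a) \<Rightarrow> (real \<times> 'a \<Rightarrow> real) set" where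
  "dom_L0 T D A =
     {\<lambda>p. \<Sum>g\<in>G. c g * g p | G c. finite G \<and> G \<subseteq> exp_generators T D A}"

text \<open>\<open>L0 u\<close> is defined on \<open>DF\<close>; it is extended by zero. Condition (b) in \<open>FP_solutions\<close> forces the
  complement of \<open>DF\<close> to be a null set, so this extension is immaterial.\<close>

definition L0 ::
  "real \<Rightarrow> 'a::real_inner set \<Rightarrow> ('a \<Rightarrow> 'a) \<Rightarrow> ('a \<Rightarrow>\<^sub>L 'a) \<Rightarrow> (real \<times> 'a) set \<Rightarrow>
   (real \<times> 'a \<Rightarrow> 'a) \<Rightarrow> (real \<times> 'a \<Rightarrow> real) \<Rightarrow> real \<times> 'a \<Rightarrow> real" where
  "L0 T D A C DF F u = (\<lambda>(t, x).
     if (t, x) \<in> DF then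
       vector_derivative (\<lambda>r. u (r, x)) (at t within {0..T})
       + 1 / 2 * op_trace (\<lambda>e. blinfun_apply C
           (frechet_derivative (grad (\<lambda>z. u (t, z))) (at x) e))
       + x \<bullet> adj_op D A (grad (\<lambda>z. u (t, z)) x)
       + F (t, x) \<bullet> grad (\<lambda>z. u (t, z)) x
     else 0)"

definition ext_norm :: "(real \<times> 'a) set \<Rightarrow> (real \<times> 'a \<Rightarrow> 'a::real_normed_vector) \<Rightarrow> real \<times> 'a \<Rightarrow> ennreal" where
  "ext_norm DF F p = (if p \<in> DF then ennreal (norm (F p)) else \<infinity>)"


section \<open>Solutions of the Fokker--Planck equation\<close>

abbreviation strip :: "real \<Rightarrow> (real \<times> 'a::real_normed_vector) measure" where
  "strip T \<equiv> restrict_space borel ({0..T} \<times> UNIV)"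

definition prob_borel :: "'a::topological_space measure \<Rightarrow> bool" where
  "prob_borel M \<longleftrightarrow> prob_space M \<and> sets M = sets borel"

text \<open>Condition (a): $\mu(dt,dx) = \mu_t(dx)\,dt$ on $[s,T] \times H$; the family
  $(\mu_t)$ is \<open>\<kappa>\<close>. The last clause also forces \<open>\<mu>\<close> to vanish off $[s,T] \times H$.\<close>

definition disintegrates ::
  "real \<Rightarrow> real \<Rightarrow> (real \<times> 'a::real_normed_vector) measure \<Rightarrow> (real \<Rightarrow> 'a measure) \<Rightarrow> bool" where
  "disintegrates T s \<mu> \<kappa> \<longleftrightarrow>
     (\<forall>t\<in>{s..T}. prob_borel (\<kappa> t)) \<and>
     (\<forall>B\<in>sets borel. (\<lambda>t. emeasure (\<kappa> t) B) \<in> borel_measurable (restrict_space borel {s..T})) \<and>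
     (\<forall>B\<in>sets \<mu>. emeasure \<mu> B = (\<integral>\<^sup>+t\<in>{s..T}. emeasure (\<kappa> t) {x. (t, x) \<in> B} \<partial>lborel))"

definition FP_solutions ::
  "real \<Rightarrow> 'a::real_inner set \<Rightarrow> ('a \<Rightarrow> 'a) \<Rightarrow> ('a \<Rightarrow>\<^sub>L 'a) \<Rightarrow> (real \<times> 'a) set \<Rightarrow>
   (real \<times> 'a \<Rightarrow> 'a) \<Rightarrow> real \<Rightarrow> 'a measure \<Rightarrow> (real \<times> 'a) measure set" where
  "FP_solutions T D A C DF F s \<zeta> = {\<mu>.
     sets \<mu> = sets (strip T) \<and> finite_measure \<mu> \<and>
     emeasure \<mu> (space \<mu> - {s..T} \<times> UNIV) = 0 \<and>
     (\<exists>\<kappa>.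
       disintegrates T s \<mu> \<kappa> \<and>
       (\<forall>h. C1_adj_dom T D A h \<longrightarrow>
          (\<integral>\<^sup>+p\<in>{s..T} \<times> UNIV.
             (ennreal \<bar>snd p \<bullet> adj_op D A (h (fst p))\<bar> + ext_norm DF F p) \<partial>\<mu>) < \<infinity>) \<and>
       (\<forall>u\<in>dom_L0 T D A. set_integrable \<mu> ({s..T} \<times> UNIV) (L0 T D A C DF F u)) \<and>
       (\<forall>u\<in>dom_L0 T D A. AE t in lborel. t \<in> {s..T} \<longrightarrow>
          (\<integral>y. u (t, y) \<partial>\<kappa> t) =
          (\<integral>y. u (s, y) \<partial>\<zeta>)
          + (LBINT r:{s..t}. (\<integral>y. L0 T D A C DF F u (r, y) \<partial>\<kappa> r))))}"


section \<open>Convex sets of measures and density in $L^1$\<close>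

definition mix_measure :: "real \<Rightarrow> 'b measure \<Rightarrow> 'b measure \<Rightarrow> 'b measure" where
  "mix_measure c M N =
     measure_of (space M) (sets M) (\<lambda>B. ennreal c * emeasure M B + ennreal (1 - c) * emeasure N B)"

lemma sets_mix_measure [simp]: "sets (mix_measure c M N) = sets M"
  and space_mix_measure [simp]: "space (mix_measure c M N) = space M"
  by (simp_all add: mix_measure_def)

lemma emeasure_mix_measure:
  assumes "sets N = sets M" "B \<in> sets M"
  shows "emeasure (mix_measure c M N) B =
         ennreal c * emeasure M B + ennreal (1 - c) * emeasure N B"
  unfolding mix_measure_def
proof (rule emeasure_measure_of_sigma)
  show "sigma_algebra (space M) (sets M)" by (rule sets.sigma_algebra_axioms)
  show "positive (sets M) (\<lambda>B. ennreal c * emeasure M B + ennreal (1 - c) * emeasure N B)"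
    by (simp add: positive_def)
  show "countably_additive (sets M)
          (\<lambda>B. ennreal c * emeasure M B + ennreal (1 - c) * emeasure N B)"
  proof (rule countably_additiveI)
    fix X :: "nat \<Rightarrow> 'a set"
    assume X: "range X \<subseteq> sets M" "disjoint_family X"
    have "(\<Sum>i. ennreal c * emeasure M (X i) + ennreal (1 - c) * emeasure N (X i)) =
          ennreal c * (\<Sum>i. emeasure M (X i)) + ennreal (1 - c) * (\<Sum>i. emeasure N (X i))"
      by (simp add: suminf_add[symmetric])
    then show "(\<Sum>i. ennreal c * emeasure M (X i) + ennreal (1 - c) * emeasure N (X i)) =
          ennreal c * emeasure M (\<Union> (range X)) + ennreal (1 - c) * emeasure N (\<Union> (range X))"
      using X assms(1) by (simp add: suminf_emeasure)
  qed
  show "B \<in> sets M" by (rule assms(2))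
qed

definition convex_measures :: "'b measure set \<Rightarrow> bool" where
  "convex_measures K \<longleftrightarrow> (\<forall>\<mu>\<in>K. \<forall>\<nu>\<in>K. \<forall>c\<in>{0..1}. mix_measure c \<mu> \<nu> \<in> K)"

definition dense_in_L1 :: "'b measure \<Rightarrow> ('b \<Rightarrow> real) set \<Rightarrow> bool" where
  "dense_in_L1 \<mu> V \<longleftrightarrow>
     (\<forall>g\<in>V. integrable \<mu> g) \<and>
     (\<forall>f. integrable \<mu> f \<longrightarrow> (\<forall>\<epsilon>>0. \<exists>g\<in>V. (\<integral>p. \<bar>f p - g p\<bar> \<partial>\<mu>) < \<epsilon>))"

end

theory Submission
  imports Defs
begin

text \<open>
  Two elements \<open>\<mu>, \<nu>\<close> of \<open>K\<close> give the same integral to every \<open>L\<^sub>0 u\<close>: letting \<open>t\<close> tend to \<open>T\<close> in the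
  Fokker--Planck equation, the left-hand side vanishes because \<open>u(t, \<cdot>)\<close> tends to \<open>0\<close> uniformly, so
  that the integral of \<open>L\<^sub>0 u\<close> is determined by \<open>\<zeta>\<close>. Both measures are dominated by twice their
  midpoint, hence convergence in \<open>L\<^sup>1\<close> of the midpoint implies convergence of both integrals. The
  dense range condition for the midpoint therefore transfers equality from the range of \<open>L\<^sub>0\<close> to
  all indicator functions.
\<close>

section \<open>Domination by the midpoint and density in L1\<close>

text \<open>Twice the midpoint is the sum of the two measures, so it dominates each of them, and
  nonnegative integrals are monotone in the measure.\<close>

lemma nn_integral_le_mix_measure:
  assumes sets: "sets N = sets M"
    and f: "f \<in> borel_measurable M"
  shows "(\<integral>\<^sup>+x. f x \<partial>M) \<le> 2 * (\<integral>\<^sup>+x. f x \<partial>mix_measure (1/2) M N)"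
    and "(\<integral>\<^sup>+x. f x \<partial>N) \<le> 2 * (\<integral>\<^sup>+x. f x \<partial>mix_measure (1/2) M N)"
proof -
  let ?Q = "mix_measure (1/2) M N"
  have "2 * ennreal (1/2) = ennreal (2 * (1/2))"
    by (subst ennreal_mult) simp_all
  then have two: "2 * (ennreal (1/2) * x) = x" for x
    by (simp add: mult.assoc[symmetric])
  have em: "2 * emeasure ?Q B = emeasure M B + emeasure N B" if "B \<in> sets M" for B
    using emeasure_mix_measure[OF sets that, of "1/2"] two
    by (simp only: distrib_left) simp
  have f': "f \<in> borel_measurable ?Q"
    using f by (simp cong: measurable_cong_sets)
  \<comment> \<open>For measures with the same sets the order is setwise. Sets outside the
    sigma-algebra have measure 0 on both sides, so the comparison extends to all sets.\<close>
  have "M \<le> scale_measure 2 ?Q"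
    by (subst le_measure) (auto simp: le_fun_def em emeasure_notin_sets add_increasing2)
  from nn_integral_mono_measure[OF _ this, of f] nn_integral_scale_measure[OF f', of 2]
  show "(\<integral>\<^sup>+x. f x \<partial>M) \<le> 2 * (\<integral>\<^sup>+x. f x \<partial>?Q)"
    by simp
  have "N \<le> scale_measure 2 ?Q"
    using sets
    by (subst le_measure) (auto simp: le_fun_def em emeasure_notin_sets add_increasing2)
  from nn_integral_mono_measure[OF _ this, of f] nn_integral_scale_measure[OF f', of 2] sets
  show "(\<integral>\<^sup>+x. f x \<partial>N) \<le> 2 * (\<integral>\<^sup>+x. f x \<partial>?Q)"
    by simp
qed

text \<open>An indicator is approximated by some \<open>g\<close> in \<open>V\<close> in L1 of the
  midpoint. By domination the same \<open>g\<close> is a good approximation for \<open>M\<close> and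
  for \<open>N\<close>, and the two integrals of \<open>g\<close> agree.\<close>

lemma measure_eqI_dense_in_L1:
  fixes M N :: "'b measure"
  assumes sets: "sets N = sets M"
    and fin: "finite_measure M" "finite_measure N" "finite_measure (mix_measure (1/2) M N)"
    and int: "\<And>g. g \<in> V \<Longrightarrow> integrable M g" "\<And>g. g \<in> V \<Longrightarrow> integrable N g"
    and dense: "dense_in_L1 (mix_measure (1/2) M N) V"
    and eq: "\<And>g. g \<in> V \<Longrightarrow> (\<integral>x. g x \<partial>M) = (\<integral>x. g x \<partial>N)"
  shows "M = N"
proof (rule measure_eqI)
  interpret M: finite_measure M by fact
  interpret N: finite_measure N by fact
  let ?Q = "mix_measure (1/2) M N"
  interpret Q: finite_measure ?Q by fact
  show "sets M = sets N" using sets ..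
  fix B assume B: "B \<in> sets M"
  \<comment> \<open>\<open>R\<close> stands for either of the two measures. The domination is an
    inequality between nonnegative integrals; integrability of \<open>g\<close> under
    \<open>R\<close> and under \<open>?Q\<close> makes both sides finite and carries it over to real
    integrals.\<close>
  have close: "\<bar>measure R B - (\<integral>x. g x \<partial>R)\<bar> \<le> 2 * (\<integral>x. \<bar>indicator B x - g x\<bar> \<partial>?Q)"
    if R: "sets R = sets M" "finite_measure R" "integrable R g"
      "\<And>f. f \<in> borel_measurable M \<Longrightarrow> (\<integral>\<^sup>+x. f x \<partial>R) \<le> 2 * (\<integral>\<^sup>+x. f x \<partial>?Q)"
      and g: "g \<in> V" for R g
  proof -
    interpret R: finite_measure R by fact
    have iB: "integrable R (indicator B :: 'b \<Rightarrow> real)"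
      using B R(1) by (simp add: less_top[symmetric])
    have iBQ: "integrable ?Q (indicator B :: 'b \<Rightarrow> real)"
      using B by (simp add: less_top[symmetric])
    have gQ: "integrable ?Q g" using dense g by (auto simp: dense_in_L1_def)
    have gM: "(\<lambda>x. ennreal \<bar>indicator B x - g x\<bar>) \<in> borel_measurable M"
      using borel_measurable_integrable[OF int(1)[OF g]] B by measurable
    have "measure R B - (\<integral>x. g x \<partial>R) = (\<integral>x. indicator B x - g x \<partial>R)"
      using iB R(3) B R(1) by simp
    then have "\<bar>measure R B - (\<integral>x. g x \<partial>R)\<bar> \<le> (\<integral>x. \<bar>indicator B x - g x\<bar> \<partial>R)"
      using integral_abs_bound by metis
    also have "\<dots> \<le> 2 * (\<integral>x. \<bar>indicator B x - g x\<bar> \<partial>?Q)"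
    proof -
      have "ennreal (\<integral>x. \<bar>indicator B x - g x\<bar> \<partial>R) = (\<integral>\<^sup>+x. \<bar>indicator B x - g x\<bar> \<partial>R)"
        using iB R(3) by (intro nn_integral_eq_integral[symmetric]) auto
      also have "\<dots> \<le> 2 * (\<integral>\<^sup>+x. \<bar>indicator B x - g x\<bar> \<partial>?Q)"
        using R(4)[OF gM] .
      also have "(\<integral>\<^sup>+x. \<bar>indicator B x - g x\<bar> \<partial>?Q) = ennreal (\<integral>x. \<bar>indicator B x - g x\<bar> \<partial>?Q)"
        using iBQ gQ by (intro nn_integral_eq_integral) auto
      also have "2 * \<dots> = ennreal (2 * (\<integral>x. \<bar>indicator B x - g x\<bar> \<partial>?Q))"
        by (simp add: ennreal_mult)
      finally show ?thesis by (simp add: ennreal_le_iff)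
    qed
    finally show ?thesis .
  qed
  have "\<bar>measure M B - measure N B\<bar> \<le> 0 + e" if e: "e > 0" for e
  proof -
    have "integrable ?Q (indicator B :: 'b \<Rightarrow> real)"
      using B by (simp add: less_top[symmetric])
    \<comment> \<open>One factor 2 comes from the domination, the other from using
      \<open>close\<close> once for each measure.\<close>
    moreover have "e / 4 > 0" using e by simp
    ultimately obtain g where g: "g \<in> V" "(\<integral>x. \<bar>indicator B x - g x\<bar> \<partial>?Q) < e / 4"
      using dense unfolding dense_in_L1_def by blast
    note close[OF refl fin(1) int(1)[OF g(1)] nn_integral_le_mix_measure(1)[OF sets] g(1)]
    moreover note close[OF sets fin(2) int(2)[OF g(1)] nn_integral_le_mix_measure(2)[OF sets] g(1)]
    ultimately show ?thesis using g(2) eq[OF g(1)] by linarith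
  qed
  then have "measure M B = measure N B"
    using field_le_epsilon[of "\<bar>measure M B - measure N B\<bar>" 0] by simp
  then show "emeasure M B = emeasure N B"
    by (simp add: M.emeasure_eq_measure N.emeasure_eq_measure)
qed

section \<open>Integration along a kernel and disintegration\<close>

text \<open>Fubini for kernels and real integrands: the formula for nonnegative functions is applied
  to the positive and the negative part, whose total integrals are finite.\<close>

lemma integral_bind_kernel:
  fixes f :: "'c \<Rightarrow> real"
  assumes k: "k \<in> measurable M (subprob_algebra N)" and ne: "space M \<noteq> {}"
    and f: "integrable (M \<bind> k) f"
  shows "integrable M (\<lambda>x. \<integral>y. f y \<partial>k x)"
    and "(\<integral>x. (\<integral>y. f y \<partial>k x) \<partial>M) = (\<integral>y. f y \<partial>(M \<bind> k))"
proof -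
  let ?p = "\<lambda>x. \<integral>\<^sup>+y. ennreal (f y) \<partial>k x" and ?n = "\<lambda>x. \<integral>\<^sup>+y. ennreal (- f y) \<partial>k x"
  have sets: "sets (M \<bind> k) = sets N" by (rule sets_bind[OF sets_kernel[OF k] ne])
  have fN [measurable]: "f \<in> borel_measurable N"
    using borel_measurable_integrable[OF f] measurable_cong_sets[OF sets refl] by auto
  have mp [measurable]: "?p \<in> borel_measurable M" and mn [measurable]: "?n \<in> borel_measurable M"
    using k by (auto intro!: measurable_compose[OF k] nn_integral_measurable_subprob_algebra)
  have ip: "(\<integral>\<^sup>+x. ?p x \<partial>M) = (\<integral>\<^sup>+y. ennreal (f y) \<partial>(M \<bind> k))"
    by (intro nn_integral_bind[OF _ k, symmetric]) measurable
  have in': "(\<integral>\<^sup>+x. ?n x \<partial>M) = (\<integral>\<^sup>+y. ennreal (- f y) \<partial>(M \<bind> k))"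
    by (intro nn_integral_bind[OF _ k, symmetric]) measurable
  have fin: "(\<integral>\<^sup>+x. ?p x \<partial>M) \<noteq> \<infinity>" "(\<integral>\<^sup>+x. ?n x \<partial>M) \<noteq> \<infinity>"
    using f unfolding ip in' real_integrable_def by auto
  have AEp: "AE x in M. ?p x \<noteq> \<infinity>" and AEn: "AE x in M. ?n x \<noteq> \<infinity>"
    using nn_integral_PInf_AE[OF mp] nn_integral_PInf_AE[OF mn] fin by blast+
  have intp: "integrable M (\<lambda>x. enn2real (?p x))" "(\<integral>x. enn2real (?p x) \<partial>M) = enn2real (\<integral>\<^sup>+x. ?p x \<partial>M)"
    and intn: "integrable M (\<lambda>x. enn2real (?n x))" "(\<integral>x. enn2real (?n x) \<partial>M) = enn2real (\<integral>\<^sup>+x. ?n x \<partial>M)"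
  proof -
    \<comment> \<open>\<open>enn2real\<close> sends infinity to 0. This alters \<open>g\<close> on a
      null set only, because its integral is finite.\<close>
    have aux: "integrable M (\<lambda>x. enn2real (g x)) \<and> (\<integral>x. enn2real (g x) \<partial>M) = enn2real (\<integral>\<^sup>+x. g x \<partial>M)"
      if [measurable]: "g \<in> borel_measurable M" and "(\<integral>\<^sup>+x. g x \<partial>M) \<noteq> \<infinity>" for g
    proof -
      have "AE x in M. ennreal (enn2real (g x)) = g x"
        using nn_integral_PInf_AE[OF that] by eventually_elim (simp add: less_top)
      then have eq: "(\<integral>\<^sup>+x. ennreal (enn2real (g x)) \<partial>M) = (\<integral>\<^sup>+x. g x \<partial>M)"
        by (rule nn_integral_cong_AE)
      show ?thesis
        using eq that by (auto simp: integrable_iff_bounded integral_eq_nn_integral less_top)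
    qed
    show "integrable M (\<lambda>x. enn2real (?p x))" "(\<integral>x. enn2real (?p x) \<partial>M) = enn2real (\<integral>\<^sup>+x. ?p x \<partial>M)"
      "integrable M (\<lambda>x. enn2real (?n x))" "(\<integral>x. enn2real (?n x) \<partial>M) = enn2real (\<integral>\<^sup>+x. ?n x \<partial>M)"
      using aux[OF mp fin(1)] aux[OF mn fin(2)] by auto
  qed
  \<comment> \<open>For exceptional \<open>x\<close>, \<open>f\<close> may fail to be integrable
    under \<open>k x\<close>; the inner integral then has the default value 0, so the identity is
    claimed almost everywhere.\<close>
  have eq: "AE x in M. (\<integral>y. f y \<partial>k x) = enn2real (?p x) - enn2real (?n x)"
    using AEp AEn AE_space
  proof eventually_elim
    case (elim x)
    then have "f \<in> borel_measurable (k x)"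
      using fN measurable_cong_sets[OF sets_kernel[OF k] refl] by blast
    with elim have "integrable (k x) f" by (simp add: real_integrable_def)
    then show ?case by (rule real_lebesgue_integral_def)
  qed
  have meas [measurable]: "(\<lambda>x. \<integral>y. f y \<partial>k x) \<in> borel_measurable M"
    by (rule measurable_compose[OF k]) (rule integral_measurable_subprob_algebra[OF fN])
  show "integrable M (\<lambda>x. \<integral>y. f y \<partial>k x)"
    using integrable_cong_AE[OF meas _ eq] intp(1) intn(1) by simp
  have "(\<integral>x. (\<integral>y. f y \<partial>k x) \<partial>M) = (\<integral>x. enn2real (?p x) - enn2real (?n x) \<partial>M)"
    by (rule integral_cong_AE[OF meas _ eq]) measurable
  also have "\<dots> = (\<integral>y. f y \<partial>(M \<bind> k))"
    using intp intn by (simp add: real_lebesgue_integral_def[OF f] ip in')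
  finally show "(\<integral>x. (\<integral>y. f y \<partial>k x) \<partial>M) = (\<integral>y. f y \<partial>(M \<bind> k))" .
qed

text \<open>The disintegration is given on sets only. It exhibits \<open>\<mu>\<close> as Lebesgue
  measure on \<open>{s..T}\<close> composed with a kernel, and Fubini for kernels extends it to
  integrable functions.\<close>

lemma disintegrates_integral:
  fixes \<mu> :: "(real \<times> 'a::{real_normed_vector, polish_space}) measure" and f :: "real \<times> 'a \<Rightarrow> real"
  assumes dis: "disintegrates T s \<mu> \<kappa>" and sets: "sets \<mu> = sets (strip T)"
    and s: "s \<in> {0..T}" and f: "integrable \<mu> f"
  shows "set_integrable lborel {s..T} (\<lambda>t. \<integral>y. f (t, y) \<partial>\<kappa> t)"
    and "(LBINT t:{s..T}. (\<integral>y. f (t, y) \<partial>\<kappa> t)) = (\<integral>p. f p \<partial>\<mu>)"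
proof -
  let ?M = "restrict_space lborel {s..T}" and ?N = "strip T :: (real \<times> 'a) measure"
  \<comment> \<open>\<open>k t\<close> is \<open>\<kappa> t\<close> carried to the fibre over
    \<open>t\<close>, so that the kernel takes values in measures on the strip.\<close>
  define k where "k = (\<lambda>t. distr (\<kappa> t) ?N (Pair t))"
  have k\<kappa>: "prob_space (\<kappa> t)" "sets (\<kappa> t) = sets borel" if "t \<in> {s..T}" for t
    using dis that by (auto simp: disintegrates_def prob_borel_def)
  have [measurable_cong]: "sets ?M = sets (restrict_space borel {s..T})"
    by (simp add: sets_restrict_space)
  have \<kappa>: "\<kappa> \<in> measurable ?M (subprob_algebra borel)"
  proof (rule measurable_subprob_algebra)
    fix B :: "'a set" assume "B \<in> sets borel"
    then show "(\<lambda>t. emeasure (\<kappa> t) B) \<in> borel_measurable ?M"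
      using dis by (auto simp: disintegrates_def cong: measurable_cong_sets)
  qed (use k\<kappa> in \<open>auto intro: prob_space_imp_subprob_space\<close>)
  have Pair: "Pair t \<in> measurable (\<kappa> t) ?N" if "t \<in> {s..T}" for t
  proof -
    have "Pair t \<in> measurable borel (borel :: (real \<times> 'a) measure)"
      by (intro borel_measurable_continuous_onI continuous_intros)
    then have "Pair t \<in> measurable borel ?N"
      using that s by (intro measurable_restrict_space2) auto
    then show ?thesis using k\<kappa>(2)[OF that] by (simp cong: measurable_cong_sets)
  qed
  \<comment> \<open>By second countability the Borel sets of the product form the product
    sigma-algebra, which makes the pairing map jointly measurable.\<close>
  have id: "(\<lambda>(t, y). (t, y)) \<in> measurable (?M \<Otimes>\<^sub>M borel) ?N"
  proof (rule measurable_restrict_space2)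
    show "(\<lambda>(t, y). (t, y)) \<in> space (?M \<Otimes>\<^sub>M (borel :: 'a measure)) \<rightarrow> {0..T} \<times> UNIV"
      using s by (auto simp: space_pair_measure)
    have "(\<lambda>t. t) \<in> measurable ?M borel" by (rule measurable_restrict_space1) simp
    then have "(\<lambda>p. (fst p, snd p)) \<in> measurable (?M \<Otimes>\<^sub>M borel) (borel \<Otimes>\<^sub>M (borel :: 'a measure))"
      by (intro measurable_Pair measurable_compose[OF measurable_fst] measurable_snd) auto
    then show "(\<lambda>(t, y). (t, y)) \<in> measurable (?M \<Otimes>\<^sub>M (borel :: 'a measure)) borel"
      by (simp add: borel_prod)
  qed
  have k: "k \<in> measurable ?M (subprob_algebra ?N)"
    unfolding k_def by (rule measurable_distr2[OF id \<kappa>])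
  have ne: "space ?M \<noteq> {}" using s by auto
  have \<mu>: "\<mu> = ?M \<bind> k"
  proof (rule measure_eqI)
    show "sets \<mu> = sets (?M \<bind> k)" using sets_bind[OF sets_kernel[OF k] ne] sets by simp
    fix B assume B: "B \<in> sets \<mu>"
    then have BN: "B \<in> sets ?N" using sets by simp
    have "emeasure (?M \<bind> k) B = (\<integral>\<^sup>+t. emeasure (k t) B \<partial>?M)"
      by (rule emeasure_bind[OF ne k BN])
    also have "\<dots> = (\<integral>\<^sup>+t\<in>{s..T}. emeasure (k t) B \<partial>lborel)"
      by (simp add: nn_integral_restrict_space)
    also have "\<dots> = (\<integral>\<^sup>+t\<in>{s..T}. emeasure (\<kappa> t) {x. (t, x) \<in> B} \<partial>lborel)"
    proof (intro nn_integral_cong)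
      fix t
      \<comment> \<open>Outside \<open>{s..T}\<close> nothing is known about
        \<open>\<kappa> t\<close>; there the indicator makes both integrands vanish.\<close>
      have "emeasure (k t) B = emeasure (\<kappa> t) {x. (t, x) \<in> B}" if t: "t \<in> {s..T}"
      proof -
        have "space (\<kappa> t) = UNIV" using sets_eq_imp_space_eq[OF k\<kappa>(2)[OF t]] by simp
        then show ?thesis unfolding k_def emeasure_distr[OF Pair[OF t] BN] by (simp add: vimage_def)
      qed
      then show "emeasure (k t) B * indicator {s..T} t =
          emeasure (\<kappa> t) {x. (t, x) \<in> B} * indicator {s..T} t"
        by (auto simp: indicator_def)
    qed
    also have "\<dots> = emeasure \<mu> B" using dis B by (simp add: disintegrates_def)
    finally show "emeasure \<mu> B = emeasure (?M \<bind> k) B" ..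
  qed
  have fN: "f \<in> borel_measurable ?N"
    using borel_measurable_integrable[OF f] measurable_cong_sets[OF sets refl] by auto
  have kf: "(\<integral>p. f p \<partial>k t) = (\<integral>y. f (t, y) \<partial>\<kappa> t)" if "t \<in> {s..T}" for t
    unfolding k_def by (rule integral_distr[OF Pair[OF that] fN])
  have fk: "integrable (?M \<bind> k) f" using f unfolding \<mu> .
  have "integrable ?M (\<lambda>t. \<integral>y. f (t, y) \<partial>\<kappa> t)"
    using integral_bind_kernel(1)[OF k ne fk] kf
    by (subst Bochner_Integration.integrable_cong[OF refl, of _ _ "\<lambda>t. \<integral>p. f p \<partial>k t"]) auto
  then show "set_integrable lborel {s..T} (\<lambda>t. \<integral>y. f (t, y) \<partial>\<kappa> t)"
    by (simp add: integrable_restrict_space set_integrable_def)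
  have "(\<integral>t. (\<integral>y. f (t, y) \<partial>\<kappa> t) \<partial>?M) = (\<integral>p. f p \<partial>\<mu>)"
    using integral_bind_kernel(2)[OF k ne fk] kf unfolding \<mu>
    by (subst Bochner_Integration.integral_cong[OF refl, of _ _ "\<lambda>t. \<integral>p. f p \<partial>k t"]) auto
  then show "(LBINT t:{s..T}. (\<integral>y. f (t, y) \<partial>\<kappa> t)) = (\<integral>p. f p \<partial>\<mu>)"
    by (simp add: integral_restrict_space set_lebesgue_integral_def)
qed

section \<open>The Fokker-Planck equation at the terminal time\<close>

text \<open>The exponential factor has modulus 1, so each generator is bounded by the norm of its
  \<open>\<phi>\<close>, which is continuous at \<open>T\<close> and vanishes there. The bound must
  not depend on \<open>y\<close>, since it is integrated against measures that vary with
  \<open>t\<close>.\<close>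

lemma dom_L0_bound:
  assumes u: "u \<in> dom_L0 T D A" and T: "T > 0"
  obtains b :: "real \<Rightarrow> real" where "(b \<longlongrightarrow> 0) (at T within {0..T})" "\<And>t y. \<bar>u (t, y)\<bar> \<le> b t"
proof -
  obtain G c where G: "finite G" "G \<subseteq> exp_generators T D A" and u_eq: "u = (\<lambda>p. \<Sum>g\<in>G. c g * g p)"
    using u by (auto simp: dom_L0_def)
  have "\<exists>b. (b \<longlongrightarrow> 0) (at T within {0..T}) \<and> (\<forall>t y. \<bar>g (t, y)\<bar> \<le> b t)" if "g \<in> G" for g
  proof -
    obtain \<phi> h where g: "g = (\<lambda>p. Re (exp_fun \<phi> h p))" and \<phi>: "C1_scalar T \<phi>" "\<phi> T = 0"
      using G(2) \<open>g \<in> G\<close> by (auto simp: exp_generators_def)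
    obtain \<phi>' where "(\<phi> has_vector_derivative \<phi>' T) (at T within {0..T})"
      using \<phi>(1) T unfolding C1_scalar_def by (metis atLeastAtMost_iff less_imp_le order_refl)
    then have "(\<phi> \<longlongrightarrow> 0) (at T within {0..T})"
      using has_vector_derivative_continuous \<phi>(2) unfolding continuous_within by metis
    then have "((\<lambda>t. norm (\<phi> t)) \<longlongrightarrow> 0) (at T within {0..T})"
      by (rule tendsto_norm_zero)
    moreover have "\<bar>g (t, y)\<bar> \<le> norm (\<phi> t)" for t y
      using abs_Re_le_cmod[of "\<phi> t * exp (\<i> * complex_of_real (y \<bullet> h t))"]
      by (simp add: g exp_fun_def norm_mult)
    ultimately show ?thesis by blast
  qed
  then obtain b where b: "\<And>g. g \<in> G \<Longrightarrow> (b g \<longlongrightarrow> 0) (at T within {0..T})"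
    "\<And>g t y. g \<in> G \<Longrightarrow> \<bar>g (t, y)\<bar> \<le> b g t"
    by metis
  show ?thesis
  proof
    have "((\<lambda>t. \<Sum>g\<in>G. \<bar>c g\<bar> * b g t) \<longlongrightarrow> (\<Sum>g\<in>G. \<bar>c g\<bar> * 0)) (at T within {0..T})"
      by (intro tendsto_intros b)
    then show "((\<lambda>t. \<Sum>g\<in>G. \<bar>c g\<bar> * b g t) \<longlongrightarrow> 0) (at T within {0..T})" by simp
    fix t y
    have "\<bar>u (t, y)\<bar> \<le> (\<Sum>g\<in>G. \<bar>c g * g (t, y)\<bar>)" unfolding u_eq by (rule sum_abs)
    also have "\<dots> \<le> (\<Sum>g\<in>G. \<bar>c g\<bar> * b g t)"
      by (intro sum_mono) (simp add: abs_mult b mult_left_mono)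
    finally show "\<bar>u (t, y)\<bar> \<le> (\<Sum>g\<in>G. \<bar>c g\<bar> * b g t)" .
  qed
qed

text \<open>Integrability need not be checked when this is applied: a non-integrable function has
  integral 0 by convention, and the bound is nonnegative.\<close>

lemma (in prob_space) abs_integral_le:
  fixes f :: "'a \<Rightarrow> real"
  assumes "\<And>x. \<bar>f x\<bar> \<le> b"
  shows "\<bar>\<integral>x. f x \<partial>M\<bar> \<le> b"
proof (cases "integrable M f")
  case True
  then have "(\<integral>x. \<bar>f x\<bar> \<partial>M) \<le> b" using assms by (intro integral_le_const) auto
  then show ?thesis using integral_abs_bound[of M f] by linarith
next
  case False
  have "0 \<le> b" using assms abs_ge_zero order_trans by blast
  with False show ?thesis by (simp add: not_integrable_integral_eq)
qed

text \<open>The equation holds only for almost every \<open>t\<close>, so \<open>t = T\<close>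
  cannot be inserted. If \<open>l\<close> were nonzero, the bound would fail on a whole interval to
  the left of \<open>T\<close>, which has positive measure.\<close>

lemma AE_bound_imp_endpoint_zero:
  fixes d b :: "real \<Rightarrow> real"
  assumes sT: "s < T"
    and d: "(d \<longlongrightarrow> l) (at T within {s..T})" and b: "(b \<longlongrightarrow> 0) (at T within {s..T})"
    and AE: "AE t in lborel. t \<in> {s..T} \<longrightarrow> \<bar>d t\<bar> \<le> b t"
  shows "l = 0"
proof (rule ccontr)
  assume "l \<noteq> 0"
  have "((\<lambda>t. \<bar>d t\<bar> - b t) \<longlongrightarrow> \<bar>l\<bar> - 0) (at T within {s..T})"
    by (intro tendsto_intros d b)
  then have "\<forall>\<^sub>F t in at T within {s..T}. \<bar>d t\<bar> - b t > 0"
    by (rule order_tendstoD) (use \<open>l \<noteq> 0\<close> in simp)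
  then obtain e where e: "e > 0"
    "\<And>t. t \<in> {s..T} \<Longrightarrow> t \<noteq> T \<Longrightarrow> dist t T < e \<Longrightarrow> \<bar>d t\<bar> - b t > 0"
    unfolding eventually_at by blast
  \<comment> \<open>The maximum keeps the interval both inside \<open>{s..T}\<close> and within
    distance \<open>e\<close> of \<open>T\<close>; it has positive length because
    \<open>s < T\<close> and \<open>e > 0\<close>.\<close>
  let ?I = "{max s (T - e)<..<T}"
  from AE obtain Z where Z: "{t \<in> space lborel. \<not> (t \<in> {s..T} \<longrightarrow> \<bar>d t\<bar> \<le> b t)} \<subseteq> Z"
    "emeasure lborel Z = 0" "Z \<in> sets lborel"
    by (rule AE_E)
  have "?I \<subseteq> Z"
  proof
    fix t assume t: "t \<in> ?I"
    then have "\<bar>d t\<bar> - b t > 0" by (intro e(2)) (auto simp: dist_real_def)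
    with t Z(1) show "t \<in> Z" by auto
  qed
  then have "emeasure lborel ?I \<le> 0" using emeasure_mono[OF _ Z(3)] Z(2) by metis
  then show False using sT e(1) by (simp add: max_def split: if_splits)
qed

text \<open>As \<open>t\<close> tends to \<open>T\<close>, the right-hand side of the equation
  converges by continuity of the indefinite integral, while the left-hand side is at most
  \<open>b t\<close>. The resulting value involves only \<open>u\<close>, \<open>s\<close> and
  \<open>\<zeta>\<close>, not \<open>\<mu>\<close>.\<close>

lemma FP_solutions_integral_L0:
  fixes \<mu> :: "(real \<times> 'a::{real_inner, polish_space}) measure"
  assumes \<mu>: "\<mu> \<in> FP_solutions T D A C DF F s \<zeta>" and T: "T > 0" and s: "0 \<le> s" "s < T"
    and u: "u \<in> dom_L0 T D A" and int: "integrable \<mu> (L0 T D A C DF F u)"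
  shows "(\<integral>p. L0 T D A C DF F u p \<partial>\<mu>) = - (\<integral>y. u (s, y) \<partial>\<zeta>)"
proof -
  obtain \<kappa> where sets: "sets \<mu> = sets (strip T)" and dis: "disintegrates T s \<mu> \<kappa>"
    and FP: "AE t in lborel. t \<in> {s..T} \<longrightarrow> (\<integral>y. u (t, y) \<partial>\<kappa> t) =
      (\<integral>y. u (s, y) \<partial>\<zeta>) + (LBINT r:{s..t}. (\<integral>y. L0 T D A C DF F u (r, y) \<partial>\<kappa> r))"
    using \<mu> u by (auto simp: FP_solutions_def)
  let ?J = "\<lambda>r. \<integral>y. L0 T D A C DF F u (r, y) \<partial>\<kappa> r" and ?Z = "\<integral>y. u (s, y) \<partial>\<zeta>"
  have sT: "s \<in> {0..T}" using s by simp
  note J = disintegrates_integral[OF dis sets sT int]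
  \<comment> \<open>The passage to the gauge integral gives access to the continuity of indefinite
    integrals.\<close>
  have J_eq: "(LBINT r:{s..t}. ?J r) = integral {s..t} ?J" if "t \<in> {s..T}" for t
    using that by (intro set_borel_integral_eq_integral set_integrable_subset[OF J(1)]) auto
  have "continuous_on {s..T} (\<lambda>t. integral {s..t} ?J)"
    by (intro indefinite_integral_continuous_1 set_borel_integral_eq_integral(1) J(1))
  then have "((\<lambda>t. integral {s..t} ?J) \<longlongrightarrow> integral {s..T} ?J) (at T within {s..T})"
    using s by (auto simp: continuous_on_def)
  then have lim: "((\<lambda>t. ?Z + integral {s..t} ?J) \<longlongrightarrow> ?Z + integral {s..T} ?J) (at T within {s..T})"
    by (intro tendsto_intros)
  obtain b where b: "(b \<longlongrightarrow> 0) (at T within {0..T})" "\<And>t y. \<bar>u (t, y)\<bar> \<le> b t"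
    using dom_L0_bound[OF u T] by blast
  have b': "(b \<longlongrightarrow> 0) (at T within {s..T})"
    using s by (intro tendsto_within_subset[OF b(1)]) auto
  \<comment> \<open>By the equation the left-hand quantity is the mean of \<open>u (t, y)\<close>
    under the probability measure \<open>\<kappa> t\<close>.\<close>
  have "AE t in lborel. t \<in> {s..T} \<longrightarrow> \<bar>?Z + integral {s..t} ?J\<bar> \<le> b t"
    using FP
  proof eventually_elim
    case (elim t)
    show ?case
    proof
      assume t: "t \<in> {s..T}"
      then interpret prob_space "\<kappa> t"
        using dis by (auto simp: disintegrates_def prob_borel_def)
      show "\<bar>?Z + integral {s..t} ?J\<bar> \<le> b t"
        using abs_integral_le[of "\<lambda>y. u (t, y)", OF b(2)] elim t J_eq[OF t] by simp
    qed
  qed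
  from AE_bound_imp_endpoint_zero[OF s(2) lim b' this]
  have "?Z + integral {s..T} ?J = 0" .
  then show ?thesis using J(2) J_eq[of T] s by simp
qed

section \<open>Uniqueness in convex sets of solutions\<close>

theorem theorem2p1:
  fixes T s :: real
    and S :: "real \<Rightarrow> 'a::{real_inner, polish_space} \<Rightarrow>\<^sub>L 'a"
    and DA :: "'a set" and A :: "'a \<Rightarrow> 'a"
    and C :: "'a \<Rightarrow>\<^sub>L 'a"
    and DF :: "(real \<times> 'a) set" and F :: "real \<times> 'a \<Rightarrow> 'a"
    and \<zeta> :: "'a measure"
    and K :: "(real \<times> 'a) measure set"
  assumes "T > 0"
    and "C0_semigroup S" and "is_generator S DA A"
    and "symmetric_nonneg C"
    and "DF \<in> sets (strip T)" and "F \<in> borel_measurable (restrict_space borel DF)"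
    and "s \<in> {0..T}" and "prob_borel \<zeta>"
    and "K \<subseteq> FP_solutions T DA A C DF F s \<zeta>" and "convex_measures K"
    and "\<And>\<mu>. \<mu> \<in> K \<Longrightarrow> dense_in_L1 \<mu> (L0 T DA A C DF F ` dom_L0 T DA A)"
  shows "\<forall>\<mu>\<in>K. \<forall>\<nu>\<in>K. \<mu> = \<nu>"
proof (intro ballI)
  fix \<mu> \<nu> assume K: "\<mu> \<in> K" "\<nu> \<in> K"
  let ?L = "L0 T DA A C DF F"
  let ?V = "?L ` dom_L0 T DA A"
  let ?Q = "mix_measure (1/2) \<mu> \<nu>"
  \<comment> \<open>Convexity makes the dense range condition available for the midpoint
    itself.\<close>
  have Q: "?Q \<in> K" using assms(10) K by (auto simp: convex_measures_def)
  have FP: "\<rho> \<in> FP_solutions T DA A C DF F s \<zeta>" if "\<rho> \<in> K" for \<rho> using assms(9) that by auto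
  have sets: "sets \<rho> = sets (strip T)" and fin: "finite_measure \<rho>" if "\<rho> \<in> K" for \<rho>
    using FP[OF that] by (auto simp: FP_solutions_def)
  \<comment> \<open>Integrability of the approximating functions is part of
    \<open>dense_in_L1\<close>.\<close>
  have int: "integrable \<rho> (?L u)" if "\<rho> \<in> K" "u \<in> dom_L0 T DA A" for \<rho> u
    using assms(11)[OF that(1)] that(2) by (auto simp: dense_in_L1_def)
  show "\<mu> = \<nu>"
  proof (cases "s < T")
    case True
    show ?thesis
    proof (rule measure_eqI_dense_in_L1)
      show "dense_in_L1 ?Q ?V" by (rule assms(11)[OF Q])
      fix g assume "g \<in> ?V"
      then obtain u where u: "u \<in> dom_L0 T DA A" and g: "g = ?L u" by auto
      show "integrable \<mu> g" "integrable \<nu> g" using int K u g by auto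
      have "(\<integral>p. ?L u p \<partial>\<rho>) = - (\<integral>y. u (s, y) \<partial>\<zeta>)" if "\<rho> \<in> K" for \<rho>
        using FP_solutions_integral_L0[OF FP[OF that] assms(1) _ True u int[OF that u]] assms(7)
        by simp
      then show "(\<integral>p. g p \<partial>\<mu>) = (\<integral>p. g p \<partial>\<nu>)" using K g by simp
    qed (use sets fin K Q in simp_all)
  next
    case False
    then have "s = T" using assms(7) by simp
    \<comment> \<open>For \<open>s = T\<close> the time interval is the single point
      \<open>T\<close>, a Lebesgue null set, so the disintegration forces every element of
      \<open>K\<close> to be the zero measure.\<close>
    have zero: "emeasure \<rho> B = 0" if \<rho>: "\<rho> \<in> K" "B \<in> sets \<rho>" for \<rho> B
    proof -
      obtain \<kappa> where "disintegrates T s \<rho> \<kappa>" using FP[OF \<rho>(1)] by (auto simp: FP_solutions_def)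
      then have "emeasure \<rho> B = (\<integral>\<^sup>+t\<in>{T}. emeasure (\<kappa> t) {x. (t, x) \<in> B} \<partial>lborel)"
        using \<rho>(2) \<open>s = T\<close> by (simp add: disintegrates_def)
      also have "\<dots> = 0" by (rule nn_integral_null_set) (simp add: null_sets_def)
      finally show ?thesis .
    qed
    show ?thesis by (rule measure_eqI) (use zero sets K in simp_all)
  qed
qed

end
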